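(* Let $\mathbb{F}$ be a field and let $f \in \mathbb{F}[x_1, \ldots, x_n]$ be a homogeneous polynomial of degree $d\ge 2$. Suppose $\mathrm{rdc}(f) = s$. Then $\mathrm{habpw}(f) \le s-1$, and in particular $\mathrm{abp}(f) \le \mathrm{habp}(f) = O(ds)$.
   Context: "Linear function" means affine function in $x_1,\dots,x_n$; homogeneous linear means zero constant term. A determinantal representation of $f$ of size $s$ is an $s\times s$ matrix $M$ of linear functions with $\mathrm{Det}(M)=f$. It is regular if its constant part $M(\mathbf{0})$ has rank $s-1$; $\mathrm{rdc}(f)$ is the minimal size of a regular determinantal representation of $f$. An ABP of width $w$ and size $s$ for $f$ is an expression $f=\mathbf{b}^T M_1\cdots M_k\mathbf{c}$ with $\mathbf{b}\in\mathbb{F}[\mathbf{x}]^{w_0}$, $\mathbf{c}\in\mathbb{F}[\mathbf{x}]^{w_k}$, $M_i\in\mathbb{F}[\mathbf{x}]^{w_{i-1}\times w_i}$ having linear functions as entries, $w_i\le w$ for all $i$, and $\sum_{i=0}^k w_i\le s$; it is homogeneous if all these entries are homogeneous linear functions. $\mathrm{abp}(f)$ (resp. $\mathrm{habp}(f)$) is the minimal size of an ABP (resp. homogeneous ABP) computing $f$, and $\mathrm{habpw}(f)$ is the minimal width of a homogeneous ABP computing $f$. *)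

theory Defs
  imports
    "HOL-Library.Poly_Mapping"
    "HOL-Library.Extended_Nat"
    "Jordan_Normal_Form.Determinant"
    "Jordan_Normal_Form.DL_Rank"
begin

text \<open>
  Multivariate polynomials are finitely supported maps from monomials (exponent vectors, themselves
  finitely supported) to coefficients, with the convolution product of
  \<^theory>\<open>HOL-Library.Poly_Mapping\<close>. The variables $x_1,\dots,x_n$ carry the indices
  $0,\dots,n-1$.
\<close>

type_synonym 'a mpoly = "(nat \<Rightarrow>\<^sub>0 nat) \<Rightarrow>\<^sub>0 'a"

definition mon_degree :: "(nat \<Rightarrow>\<^sub>0 nat) \<Rightarrow> nat" where
  "mon_degree m = (\<Sum>i\<in>Poly_Mapping.keys m. Poly_Mapping.lookup m i)"

definition polys_in :: "nat \<Rightarrow> 'a::zero mpoly set" where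
  "polys_in n = {p. \<forall>m\<in>Poly_Mapping.keys p. Poly_Mapping.keys m \<subseteq> {..<n}}"

definition const_part :: "'a::zero mpoly \<Rightarrow> 'a" where
  "const_part p = Poly_Mapping.lookup p 0"

text \<open>The zero polynomial counts as homogeneous of every degree.\<close>

definition homogeneous_poly :: "nat \<Rightarrow> 'a::zero mpoly \<Rightarrow> bool" where
  "homogeneous_poly d p \<longleftrightarrow> (\<forall>m\<in>Poly_Mapping.keys p. mon_degree m = d)"

text \<open>``Linear'' means affine: total degree at most one, constant term allowed.\<close>

definition linear_fn :: "nat \<Rightarrow> 'a::zero mpoly \<Rightarrow> bool" where
  "linear_fn n p \<longleftrightarrow> p \<in> polys_in n \<and> (\<forall>m\<in>Poly_Mapping.keys p. mon_degree m \<le> 1)"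

definition hom_linear_fn :: "nat \<Rightarrow> 'a::zero mpoly \<Rightarrow> bool" where
  "hom_linear_fn n p \<longleftrightarrow> linear_fn n p \<and> const_part p = 0"

definition det_rep :: "nat \<Rightarrow> nat \<Rightarrow> 'a::field mpoly mat \<Rightarrow> 'a mpoly \<Rightarrow> bool" where
  "det_rep n s M f \<longleftrightarrow>
     M \<in> carrier_mat s s \<and> (\<forall>p\<in>elements_mat M. linear_fn n p) \<and> det M = f"

text \<open>
  The rank condition is stated additively because of truncated subtraction: with $s - 1$ the empty
  matrix would become a regular representation of the constant $1$.
\<close>

definition regular_det_rep :: "nat \<Rightarrow> nat \<Rightarrow> 'a::field mpoly mat \<Rightarrow> 'a mpoly \<Rightarrow> bool" where
  "regular_det_rep n s M f \<longleftrightarrow>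
     det_rep n s M f \<and> vec_space.rank s (map_mat const_part M) + 1 = s"

text \<open>Minima are taken in \<^typ>\<open>enat\<close>, so that the value is \<open>\<infinity>\<close> if there is no representation.\<close>

definition rdc :: "nat \<Rightarrow> 'a::field mpoly \<Rightarrow> enat" where
  "rdc n f = Inf {enat s | s. \<exists>M. regular_det_rep n s M f}"

text \<open>
  \<open>abp_of L k w b M c f\<close>: the expression $b^T M_1 \cdots M_k c$, with layer dimensions
  $w_0,\dots,w_k$ and all entries in the class \<open>L\<close>, equals $f$. The product is bracketed from the
  right as $b \bullet (M_1 (M_2 \cdots (M_k c)))$; $k = 0$ gives $b^T c$. A layer dimension may be
  $0$, which forces $f = 0$ and so affects the minima below only for the zero polynomial.
\<close>

definition abp_of ::
  "('a::field mpoly \<Rightarrow> bool) \<Rightarrow> nat \<Rightarrow> (nat \<Rightarrow> nat) \<Rightarrow> 'a mpoly vec \<Rightarrow> (nat \<Rightarrow> 'a mpoly mat) \<Rightarrow>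
   'a mpoly vec \<Rightarrow> 'a mpoly \<Rightarrow> bool" where
  "abp_of L k w b M c f \<longleftrightarrow>
     b \<in> carrier_vec (w 0) \<and> c \<in> carrier_vec (w k) \<and>
     (\<forall>i\<in>{1..k}. M i \<in> carrier_mat (w (i - 1)) (w i)) \<and>
     (\<forall>p\<in>set\<^sub>v b. L p) \<and> (\<forall>p\<in>set\<^sub>v c. L p) \<and>
     (\<forall>i\<in>{1..k}. \<forall>p\<in>elements_mat (M i). L p) \<and>
     f = b \<bullet> foldr (\<lambda>i v. M i *\<^sub>v v) [1..<Suc k] c"

definition has_abp :: "('a::field mpoly \<Rightarrow> bool) \<Rightarrow> nat \<Rightarrow> nat \<Rightarrow> 'a mpoly \<Rightarrow> bool" where
  "has_abp L width s f \<longleftrightarrow>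
     (\<exists>k w b M c. abp_of L k w b M c f \<and> (\<forall>i\<le>k. w i \<le> width) \<and> (\<Sum>i=0..k. w i) \<le> s)"

definition abp :: "nat \<Rightarrow> 'a::field mpoly \<Rightarrow> enat" where
  "abp n f = Inf {enat s | s. \<exists>width. has_abp (linear_fn n) width s f}"

definition habp :: "nat \<Rightarrow> 'a::field mpoly \<Rightarrow> enat" where
  "habp n f = Inf {enat s | s. \<exists>width. has_abp (hom_linear_fn n) width s f}"

definition habpw :: "nat \<Rightarrow> 'a::field mpoly \<Rightarrow> enat" where
  "habpw n f = Inf {enat width | width. \<exists>s. has_abp (hom_linear_fn n) width s f}"

end

theory Submission
  imports Defs
begin

text \<open>
  Multiplying by invertible constant matrices brings a regular representation into the form
  $N = ((I + Y, v), (u^T, x))$ with $Y, u, v, x$ homogeneous linear and $Y$ of size $s - 1$.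
  With $w = (-\sum_{j<d} (-Y)^j v, 1)$ all entries of $N w$ except the last one have order
  greater than $d$, and the last one is $g = x - \sum_{j<d} (-1)^j u^T Y^j v$. Replacing the last
  column of $N$ by $N w$ does not change the determinant, so expanding along it gives
  $\det N = g \cdot q + r$ with $q$ of constant term $1$ and $r$ of order greater than $d$. Since
  $\det N$ is homogeneous of degree $d$, it equals the degree $d$ part of $g$, which is
  $\pm u^T Y^{d-2} v$: a homogeneous ABP all of whose layers have dimension $s - 1$.
\<close>

section \<open>Degree and order of polynomials\<close>

lemma mon_degree_eq_sum:
  assumes "finite A" "Poly_Mapping.keys m \<subseteq> A"
  shows "mon_degree m = (\<Sum>i\<in>A. Poly_Mapping.lookup m i)"
  unfolding mon_degree_def using assms
  by (intro sum.mono_neutral_left) (auto simp: in_keys_iff)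

lemma mon_degree_add: "mon_degree (a + b) = mon_degree a + mon_degree b"
proof -
  let ?A = "Poly_Mapping.keys a \<union> Poly_Mapping.keys b"
  have "mon_degree (a + b) = (\<Sum>i\<in>?A. Poly_Mapping.lookup (a + b) i)"
    by (intro mon_degree_eq_sum) (auto simp: Poly_Mapping.keys_add)
  also have "\<dots> = (\<Sum>i\<in>?A. Poly_Mapping.lookup a i) + (\<Sum>i\<in>?A. Poly_Mapping.lookup b i)"
    by (simp add: lookup_add sum.distrib)
  also have "\<dots> = mon_degree a + mon_degree b"
    by (simp add: mon_degree_eq_sum[of ?A])
  finally show ?thesis .
qed

lemma mon_degree_0_iff [simp]: "mon_degree m = 0 \<longleftrightarrow> m = 0"
  by (auto simp: mon_degree_def in_keys_iff intro!: poly_mapping_eqI)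

lemma homogeneous_poly_0 [simp]: "homogeneous_poly d 0"
  by (simp add: homogeneous_poly_def)

lemma homogeneous_poly_add:
  "homogeneous_poly d p \<Longrightarrow> homogeneous_poly d q \<Longrightarrow> homogeneous_poly d (p + q)"
  unfolding homogeneous_poly_def using Poly_Mapping.keys_add[of p q] by blast

lemma homogeneous_poly_uminus [simp]:
  "homogeneous_poly d (- p :: 'a::field mpoly) \<longleftrightarrow> homogeneous_poly d p"
  by (simp add: homogeneous_poly_def in_keys_iff)

lemma homogeneous_poly_mult:
  "homogeneous_poly d p \<Longrightarrow> homogeneous_poly e q \<Longrightarrow> homogeneous_poly (d + e) (p * q :: 'a::field mpoly)"
  unfolding homogeneous_poly_def using keys_mult[of p q] by (fastforce simp: mon_degree_add)

lemma homogeneous_poly_sum: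
  "(\<And>i. i \<in> I \<Longrightarrow> homogeneous_poly d (p i)) \<Longrightarrow> homogeneous_poly d (sum p I)"
  by (induction I rule: infinite_finite_induct) (auto intro: homogeneous_poly_add)

lemma homogeneous_poly_sign_mult:
  "homogeneous_poly d p \<Longrightarrow> homogeneous_poly d ((- 1) ^ j * p :: 'a::field mpoly)"
  by (cases "even j") auto

lemma homogeneous_poly_lookup:
  "homogeneous_poly d p \<Longrightarrow> mon_degree m \<noteq> d \<Longrightarrow> Poly_Mapping.lookup p m = 0"
  by (auto simp: homogeneous_poly_def in_keys_iff)

text \<open>Membership in the k-th power of the ideal generated by the variables, that is, vanishing
  to order at least k at the origin.\<close>

definition order_ge :: "nat \<Rightarrow> 'a::zero mpoly \<Rightarrow> bool" where
  "order_ge k p \<longleftrightarrow> (\<forall>m\<in>Poly_Mapping.keys p. k \<le> mon_degree m)"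

lemma order_ge_0 [simp]: "order_ge 0 p"
  by (simp add: order_ge_def)

lemma order_ge_mono: "order_ge k p \<Longrightarrow> l \<le> k \<Longrightarrow> order_ge l p"
  by (auto simp: order_ge_def)

lemma order_ge_homogeneous: "homogeneous_poly d p \<Longrightarrow> order_ge d p"
  by (auto simp: order_ge_def homogeneous_poly_def)

lemma order_ge_diff:
  "order_ge k p \<Longrightarrow> order_ge k q \<Longrightarrow> order_ge k (p - q :: 'a::field mpoly)"
  unfolding order_ge_def using Poly_Mapping.keys_diff[of p q] by blast

lemma order_ge_mult:
  "order_ge k p \<Longrightarrow> order_ge l q \<Longrightarrow> order_ge (k + l) (p * q :: 'a::field mpoly)"
  unfolding order_ge_def using keys_mult[of p q] by (fastforce simp: mon_degree_add intro: add_mono)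

lemma order_ge_sum:
  "(\<And>i. i \<in> I \<Longrightarrow> order_ge d (p i)) \<Longrightarrow> order_ge d (sum p I)"
proof (induction I rule: infinite_finite_induct)
  case (insert x F)
  then show ?case
    using Poly_Mapping.keys_add[of "p x" "sum p F"] by (fastforce simp: order_ge_def)
qed (auto simp: order_ge_def)

lemma order_ge_lookup:
  "order_ge k p \<Longrightarrow> mon_degree m < k \<Longrightarrow> Poly_Mapping.lookup p m = 0"
  unfolding order_ge_def by (metis in_keys_iff not_le)

lemma order_ge_Suc_0: "const_part p = 0 \<Longrightarrow> order_ge (Suc 0) p"
  by (auto simp: order_ge_def const_part_def in_keys_iff Suc_le_eq neq0_conv[symmetric] simp del: neq0_conv)

text \<open>Modulo any power of the ideal of variables \<open>q\<close> is a unit. Concretely, g = f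
  - g (q - 1) - r, and multiplication by q - 1 raises the order by at least one, so the order of
  \<open>g\<close> climbs step by step from 0 to \<open>d\<close>.\<close>

lemma order_ge_quotient:
  fixes f g q r :: "'a::field mpoly"
  assumes f: "order_ge d f" and r: "order_ge d r" and q: "const_part q = 1" and eq: "f = g * q + r"
  shows "order_ge d g"
proof -
  have "order_ge (Suc 0) (q - 1)"
    using q by (intro order_ge_Suc_0) (simp add: const_part_def lookup_minus)
  have "order_ge k g" if "k \<le> d" for k
    using that
  proof (induction k)
    case (Suc k)
    have "g = f - g * (q - 1) - r"
      using eq by (simp add: algebra_simps)
    moreover have "order_ge (Suc k) (g * (q - 1))"
      using order_ge_mult[OF _ \<open>order_ge (Suc 0) (q - 1)\<close>, of k g] Suc by simp
    ultimately show ?case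
      using f r Suc.prems by (metis order_ge_diff order_ge_mono)
  qed simp
  then show ?thesis by simp
qed

text \<open>Since \<open>g\<close> already has order \<open>d\<close>, the terms g (q - 1) and
  \<open>r\<close> live only in degrees above \<open>d\<close>. In degree \<open>d\<close> the
  factor \<open>q\<close> therefore acts as 1.\<close>

lemma lookup_quotient:
  fixes f g q r :: "'a::field mpoly"
  assumes f: "order_ge d f" and r: "order_ge (Suc d) r" and q: "const_part q = 1"
    and eq: "f = g * q + r" and m: "mon_degree m = d"
  shows "Poly_Mapping.lookup f m = Poly_Mapping.lookup g m"
proof -
  have "order_ge d g"
    using order_ge_quotient[OF f order_ge_mono[OF r] q eq] by simp
  moreover have "order_ge (Suc 0) (q - 1)"
    using q by (intro order_ge_Suc_0) (simp add: const_part_def lookup_minus)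
  ultimately have "order_ge (Suc d) (g * (q - 1))"
    using order_ge_mult by fastforce
  moreover have "f = g + g * (q - 1) + r"
    using eq by (simp add: algebra_simps)
  ultimately show ?thesis
    using r m by (simp add: lookup_add order_ge_lookup)
qed

section \<open>Evaluation at the origin and the embedding of constants\<close>

lemma const_part_mult: "const_part (p * q) = const_part p * const_part (q :: 'a::field mpoly)"
proof -
  \<comment> \<open>A product of monomials is 1 only if both factors are, so the convolution sum at
    the monomial 1 has a single term.\<close>
  have *: "0 = l + k \<longleftrightarrow> k = 0 \<and> l = 0" for l k :: "nat \<Rightarrow>\<^sub>0 nat"
    by (metis add.right_neutral mon_degree_0_iff mon_degree_add add_is_0)
  show ?thesis
    unfolding const_part_def lookup_mult * when_when[symmetric]
    by (simp add: Sum_any_when_independent mult_when)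
qed

text \<open>As a ring homomorphism, evaluation at the origin commutes with determinants and matrix
  products; constant parts of matrices are computed this way below.\<close>

lemma const_part_comm_ring_hom: "comm_ring_hom (const_part :: 'a::field mpoly \<Rightarrow> 'a)"
  by unfold_locales (auto simp: const_part_mult, auto simp: const_part_def lookup_add lookup_one)

lemma single_0_comm_ring_hom: "comm_ring_hom (Poly_Mapping.single 0 :: 'a::field \<Rightarrow> 'a mpoly)"
  by unfold_locales (auto simp: mult_single single_add)

section \<open>Normal form of matrices of corank one\<close>

text \<open>Fewer than \<open>n\<close> vectors cannot span a space of dimension \<open>n\<close>,
  and any vector outside their span may be added.\<close>

lemma (in vec_space) extend_lin_indpt:
  assumes S: "S \<subseteq> carrier_vec n" "finite S" "lin_indpt S" and c: "card S < n"
  obtains v where "v \<in> carrier_vec n" "v \<notin> S" "lin_indpt (insert v S)"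
proof -
  have "span S \<noteq> carrier_vec n"
    using gen_ge_dim[OF \<open>finite S\<close>] S c by (auto simp: dim_is_n)
  then obtain v where "v \<in> carrier_vec n" "v \<notin> span S"
    using span_closed[of S] S by auto
  moreover have "v \<notin> S"
    using \<open>v \<notin> span S\<close> in_own_span[of S] S by auto
  moreover have "lin_indpt (S \<union> {v})"
    using lin_dep_iff_in_span[of S v] calculation S by auto
  ultimately show thesis
    using that by simp
qed

lemma (in vec_space) det_mat_of_cols_lin_indpt:
  assumes "set bs \<subseteq> carrier_vec n" "length bs = n" "distinct bs" "lin_indpt (set bs)"
  shows "det (mat_of_cols n bs) \<noteq> 0"
proof
  let ?B = "mat_of_cols n bs"
  have B: "?B \<in> carrier_mat n n"
    using assms(2) by auto
  assume "det ?B = 0"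
  then obtain v where "v \<in> carrier_vec n" "v \<noteq> 0\<^sub>v n" "?B *\<^sub>v v = 0\<^sub>v n"
    using det_0_iff_vec_prod_zero_field[OF B] by auto
  then have "lin_dep (set (cols ?B))"
    using assms by (intro lin_depI[OF B]) (auto simp: cols_mat_of_cols)
  then show False
    using assms by (simp add: cols_mat_of_cols)
qed

lemma mult_mat_unit_vec:
  assumes "A \<in> carrier_mat nr nc" "j < nc"
  shows "A *\<^sub>v unit_vec nc j = (col A j :: 'a::semiring_1 vec)"
  using assms by (intro eq_vecI) (auto simp: scalar_prod_right_unit)

definition corank_one_mat :: "nat \<Rightarrow> 'a::field mat" where
  "corank_one_mat m = mat (Suc m) (Suc m) (\<lambda>(i, j). if i = j \<and> i < m then 1 else 0)"

text \<open>Let \<open>B\<close> consist of a maximal independent set of columns of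
  \<open>A\<close>, completed to a basis by one vector. Let \<open>Q\<close> select these columns of
  \<open>A\<close> and carry a kernel vector of \<open>A\<close> as its last column. Then A Q is
  \<open>B\<close> with its last column zeroed, and multiplying by the inverse \<open>P\<close> of
  \<open>B\<close> gives the normal form.\<close>

lemma corank_one_normal_form:
  fixes A :: "'a::field mat"
  assumes A: "A \<in> carrier_mat (Suc m) (Suc m)" and rank: "vec_space.rank (Suc m) A = m"
  obtains P Q where "P \<in> carrier_mat (Suc m) (Suc m)" "Q \<in> carrier_mat (Suc m) (Suc m)"
    "det P \<noteq> 0" "det Q \<noteq> 0" "P * A * Q = corank_one_mat m"
proof -
  interpret V: vec_space "TYPE('a)" "Suc m" .
  let ?n = "Suc m"
  have cA: "set (cols A) \<subseteq> carrier_vec ?n"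
    using A cols_dim[of A] by auto
  obtain S where S: "finite S" "maximal S (\<lambda>T. T \<subseteq> set (cols A) \<and> V.lin_indpt T)"
    using maximal_exists_superset[of "set (cols A)" "\<lambda>T. T \<subseteq> set (cols A) \<and> V.lin_indpt T" "{}"]
      V.finite_lin_indpt2[of "{}"] by auto
  have cS: "card S = m"
    using V.rank_card_indpt[OF A S(2)] rank by simp
  have SA: "S \<subseteq> set (cols A)" and liS: "V.lin_indpt S"
    using S(2) by (auto simp: maximal_def)
  obtain bs where bs: "set bs = S" "distinct bs" "length bs = m"
    using finite_distinct_list[OF S(1)] cS by (metis distinct_card)
  obtain v where v: "v \<in> carrier_vec ?n" "v \<notin> S" "V.lin_indpt (insert v S)"
    using V.extend_lin_indpt[of S] SA cA S(1) liS cS by auto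
  define B where "B = mat_of_cols ?n (bs @ [v])"
  have B: "B \<in> carrier_mat ?n ?n"
    by (auto simp: B_def bs)
  have detB: "det B \<noteq> 0"
    unfolding B_def using bs v SA cA by (intro V.det_mat_of_cols_lin_indpt) auto
  obtain P where P: "P \<in> carrier_mat ?n ?n" "P * B = 1\<^sub>m ?n"
    using det_non_zero_imp_unit[OF B detB, of "()"] by (auto simp: Units_def ring_mat_def)
  have detP: "det P \<noteq> 0"
    using det_mult[OF P(1) B] P(2) by auto
  have "\<forall>j<m. \<exists>i<?n. col A i = bs ! j"
  proof (intro allI impI)
    fix j assume "j < m"
    then have "bs ! j \<in> set (cols A)"
      using bs SA by (metis nth_mem subsetD)
    then show "\<exists>i<?n. col A i = bs ! j"
      using A by (metis carrier_matD(2) cols_length cols_nth in_set_conv_nth)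
  qed
  then obtain idx where idx: "\<And>j. j < m \<Longrightarrow> idx j < ?n \<and> col A (idx j) = bs ! j"
    by metis
  \<comment> \<open>Rank \<open>m\<close> in size \<open>Suc m\<close> means that \<open>A\<close>
    is singular, which supplies the kernel vector \<open>q\<close>.\<close>
  have "det A = 0"
    using V.det_rank_iff[OF A] rank by auto
  then obtain q where q: "q \<in> carrier_vec ?n" "q \<noteq> 0\<^sub>v ?n" "A *\<^sub>v q = 0\<^sub>v ?n"
    using det_0_iff_vec_prod_zero_field[OF A] by auto
  define Q where "Q = mat_of_cols ?n (map (\<lambda>j. unit_vec ?n (idx j)) [0..<m] @ [q])"
  have Q: "Q \<in> carrier_mat ?n ?n"
    by (auto simp: Q_def)
  have colQ: "col Q j = (if j < m then unit_vec ?n (idx j) else q)" if "j < ?n" for j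
    unfolding Q_def using that q by (subst col_mat_of_cols) (auto simp: nth_append less_Suc_eq)
  have colB: "j < m \<Longrightarrow> col B j = bs ! j" for j
    unfolding B_def using bs SA cA nth_mem[of j bs]
    by (subst col_mat_of_cols) (auto simp: nth_append simp del: nth_mem)
  have colAQ: "col (A * Q) j = (if j < m then col B j else 0\<^sub>v ?n)" if "j < ?n" for j
    using that colQ[OF that] idx[of j] colB[of j] A q
    by (auto simp: col_mult2[OF A Q that] mult_mat_unit_vec)
  have AQ: "A * Q = B * corank_one_mat m"
  proof (rule mat_col_eqI)
    fix j assume "j < dim_col (B * corank_one_mat m)"
    then have j: "j < ?n"
      by (simp add: corank_one_mat_def)
    have L: "corank_one_mat m \<in> carrier_mat ?n ?n"
      by (simp add: corank_one_mat_def)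
    have "col (corank_one_mat m) j = (if j < m then unit_vec ?n j else 0\<^sub>v ?n :: 'a vec)"
      using j by (auto simp: corank_one_mat_def unit_vec_def)
    then show "col (A * Q) j = col (B * corank_one_mat m) j"
      using j B by (auto simp: col_mult2[OF B L j] colAQ mult_mat_unit_vec)
  qed (use A B Q in \<open>auto simp: corank_one_mat_def\<close>)
  have "P * A * Q = P * (B * corank_one_mat m)"
    using AQ P A Q by (simp add: assoc_mult_mat[of _ ?n ?n _ ?n _ ?n])
  also have "\<dots> = P * B * corank_one_mat m"
    using P B by (subst assoc_mult_mat[of _ ?n ?n _ ?n _ ?n]) (auto simp: corank_one_mat_def)
  also have "\<dots> = corank_one_mat m"
    using P by (simp add: corank_one_mat_def)
  finally have PAQ: "P * A * Q = corank_one_mat m" .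
  \<comment> \<open>A kernel vector \<open>x\<close> of \<open>Q\<close> is also killed by P A Q, so
    its first \<open>m\<close> coordinates vanish. Then Q x is the multiple of \<open>q\<close> by
    the last coordinate, and \<open>q\<close> is nonzero, so x = 0.\<close>
  have "det Q \<noteq> 0"
  proof
    assume "det Q = 0"
    then obtain x where x: "x \<in> carrier_vec ?n" "x \<noteq> 0\<^sub>v ?n" "Q *\<^sub>v x = 0\<^sub>v ?n"
      using det_0_iff_vec_prod_zero_field[OF Q] by auto
    have mult_zero: "X *\<^sub>v 0\<^sub>v ?n = 0\<^sub>v ?n" if "X \<in> carrier_mat ?n ?n" for X :: "'a mat"
      using that by (intro eq_vecI) auto
    have "corank_one_mat m *\<^sub>v x = (P * A) *\<^sub>v (Q *\<^sub>v x)"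
      using PAQ P A Q x by (metis assoc_mult_mat_vec mult_carrier_mat)
    also have "\<dots> = 0\<^sub>v ?n"
      using P A by (simp add: x mult_zero)
    finally have 0: "corank_one_mat m *\<^sub>v x = 0\<^sub>v ?n" .
    have x0: "x $ i = 0" if "i < m" for i
    proof -
      have "row (corank_one_mat m) i = (unit_vec ?n i :: 'a vec)"
        using that by (auto simp: corank_one_mat_def unit_vec_def)
      then show ?thesis
        using arg_cong[OF 0, of "\<lambda>y. y $ i"] that x by (simp add: corank_one_mat_def)
    qed
    have "x = x $ m \<cdot>\<^sub>v unit_vec ?n m"
      using x x0 by (intro eq_vecI) (auto simp: less_Suc_eq)
    then have "Q *\<^sub>v x = x $ m \<cdot>\<^sub>v col Q m"
      using Q by (metis lessI mult_mat_unit_vec mult_mat_vec unit_vec_carrier)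
    then have 1: "x $ m \<cdot>\<^sub>v q = 0\<^sub>v ?n"
      using x colQ[of m] by simp
    obtain i where "i < ?n" "q $ i \<noteq> 0"
      using q by (metis carrier_vecD eq_vecI index_zero_vec)
    then have "x $ m = 0"
      using arg_cong[OF 1, of "\<lambda>y. y $ i"] q by auto
    then show False
      using x x0 by (auto simp: less_Suc_eq intro!: eq_vecI)
  qed
  then show thesis
    using that P Q detP PAQ by blast
qed

section \<open>Homogeneous determinants\<close>

lemma homogeneous_poly_scalar_prod:
  assumes "v \<in> carrier_vec k" "\<And>i. i < k \<Longrightarrow> homogeneous_poly d (u $ i)"
    "\<And>i. i < k \<Longrightarrow> homogeneous_poly e (v $ i)"
  shows "homogeneous_poly (d + e) (u \<bullet> v :: 'a::field mpoly)"
  unfolding scalar_prod_def using assms by (auto intro!: homogeneous_poly_sum homogeneous_poly_mult)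

lemma funpow_mult_mat_vec_carrier [simp]:
  "Y \<in> carrier_mat m m \<Longrightarrow> v \<in> carrier_vec m \<Longrightarrow> (((*\<^sub>v) Y ^^ j) v) \<in> carrier_vec m"
  by (induction j) auto

text \<open>Formally, det N is det (I + Y) times the Schur complement x - u^T (I + Y)^(-1) v, where
  x is the corner entry. As I + Y need not be invertible over polynomials, the inverse is replaced
  by a truncated Neumann series, whose error lies beyond the degree of det N.\<close>

lemma homogeneous_det_corank_one:
  fixes N :: "'a::field mpoly mat"
  assumes N: "N \<in> carrier_mat (Suc m) (Suc m)"
    and hom: "\<And>i j. i < Suc m \<Longrightarrow> j < Suc m \<Longrightarrow>
      homogeneous_poly 1 (N $$ (i, j) - (if i = j \<and> i < m then 1 else 0))"
    and f: "homogeneous_poly (e + 2) (det N)"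
  defines "Y \<equiv> mat m m (\<lambda>(i, j). N $$ (i, j) - (if i = j then 1 else 0))"
    and "u \<equiv> vec m (\<lambda>j. N $$ (m, j))" and "v \<equiv> vec m (\<lambda>i. N $$ (i, m))"
  shows "det N = - ((- 1) ^ e * (u \<bullet> ((*\<^sub>v) Y ^^ e) v))"
proof -
  define z where "z j = ((*\<^sub>v) Y ^^ j) v" for j
  define d where "d = e + 2"
  \<comment> \<open>The top of \<open>w\<close> is the Neumann series of -(I + Y)^(-1) v cut after
    \<open>d\<close> terms. The error involves \<open>z d\<close>, which has degree d + 1, just
    above the degree of det N.\<close>
  define w where "w = vec (Suc m) (\<lambda>i. if i < m then - (\<Sum>j<d. (- 1) ^ j * z j $ i) else 1)"
  define g where "g = N $$ (m, m) - (\<Sum>j<d. (- 1) ^ j * (u \<bullet> z j))"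
  have Y: "Y \<in> carrier_mat m m" and v: "v \<in> carrier_vec m" and u: "u \<in> carrier_vec m"
    and w: "w \<in> carrier_vec (Suc m)"
    by (auto simp: Y_def u_def v_def w_def)
  have z: "z j \<in> carrier_vec m" for j
    unfolding z_def using Y v by simp
  have zSuc: "z (Suc j) $ i = (\<Sum>k<m. Y $$ (i, k) * z j $ k)" if "i < m" for i j
    using that Y z[of j] by (simp add: z_def scalar_prod_def atLeast0LessThan)
  have homY: "homogeneous_poly 1 (Y $$ (i, j))" if "i < m" "j < m" for i j
    using hom[of i j] that by (simp add: Y_def)
  have homz: "homogeneous_poly (Suc j) (z j $ i)" if "i < m" for i j
    using that
  proof (induction j arbitrary: i)
    case 0
    then show ?case using hom[of i m] by (simp add: z_def v_def)
  next
    case (Suc j)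
    then show ?case
      unfolding zSuc[OF Suc.prems]
      using homogeneous_poly_mult[OF homY Suc.IH] by (intro homogeneous_poly_sum) auto
  qed
  have homuz: "homogeneous_poly (j + 2) (u \<bullet> z j)" for j
    using homogeneous_poly_scalar_prod[OF z, of 1 u "Suc j" j] homz hom[of m] by (simp add: u_def)
  have Nw: "(N *\<^sub>v w) $ i = (\<Sum>k<m. N $$ (i, k) * w $ k) + N $$ (i, m)" if "i < Suc m" for i
    using N w that by (simp add: scalar_prod_def atLeast0LessThan) (simp add: w_def)
  have Nw_top: "(N *\<^sub>v w) $ i = (- 1) ^ d * z d $ i" if i: "i < m" for i
  proof -
    have wk: "w $ k = - (\<Sum>j<d. (- 1) ^ j * z j $ k)" if "k < m" for k
      using that by (simp add: w_def)
    \<comment> \<open>Row \<open>i\<close> of the upper left block is split as Y + I.\<close>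
    have "(\<Sum>k<m. N $$ (i, k) * w $ k) = (\<Sum>k<m. Y $$ (i, k) * w $ k) + (\<Sum>k<m. if k = i then w $ k else 0)"
      unfolding sum.distrib[symmetric] using i by (intro sum.cong) (auto simp: Y_def algebra_simps)
    also have "(\<Sum>k<m. if k = i then w $ k else 0) = w $ i"
      using i by simp
    also have "(\<Sum>k<m. Y $$ (i, k) * w $ k) = - (\<Sum>k<m. \<Sum>j<d. (- 1) ^ j * (Y $$ (i, k) * z j $ k))"
      by (simp add: wk sum_negf sum_distrib_left algebra_simps)
    also have "\<dots> = - (\<Sum>j<d. (- 1) ^ j * z (Suc j) $ i)"
      by (subst sum.swap) (simp add: zSuc[OF i] sum_distrib_left)
    finally have "(\<Sum>k<m. N $$ (i, k) * w $ k)
        = (\<Sum>j<d. (- 1) ^ Suc j * z (Suc j) $ i - (- 1) ^ j * z j $ i)"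
      by (simp add: wk i sum_subtractf sum_negf)
    \<comment> \<open>Applying I + Y to the truncated series telescopes. The leftover
      \<open>z 0\<close>, which is \<open>v\<close>, cancels against the last column of
      \<open>N\<close>, as \<open>w\<close> ends in 1.\<close>
    also have "\<dots> = (- 1) ^ d * z d $ i - z 0 $ i"
      by (subst sum_lessThan_telescope) simp
    finally show ?thesis
      using i by (simp add: Nw z_def v_def)
  qed
  have Nw_bottom: "(N *\<^sub>v w) $ m = g"
  proof -
    have "(\<Sum>k<m. N $$ (m, k) * w $ k) = - (\<Sum>k<m. \<Sum>j<d. (- 1) ^ j * (u $ k * z j $ k))"
      by (simp add: w_def u_def sum_negf sum_distrib_left algebra_simps)
    also have "\<dots> = - (\<Sum>j<d. (- 1) ^ j * (u \<bullet> z j))"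
      by (subst sum.swap) (simp add: scalar_prod_def sum_distrib_left atLeast0LessThan carrier_vecD[OF z])
    finally show ?thesis
      by (simp add: Nw g_def)
  qed
  define R where "R = replace_col N (N *\<^sub>v w) m"
  have R: "R \<in> carrier_mat (Suc m) (Suc m)"
    using N by (simp add: R_def replace_col_def)
  have R_col: "R $$ (i, m) = (N *\<^sub>v w) $ i" if "i < Suc m" for i
    using N that by (simp add: R_def replace_col_def)
  have R_top: "R $$ (i, m) = (- 1) ^ d * z d $ i" if "i < m" for i
    using that R_col Nw_top by (metis less_SucI)
  have R_bottom: "R $$ (m, m) = g"
    using R_col Nw_bottom by (metis lessI)
  \<comment> \<open>Cramer's rule: replacing column \<open>m\<close> by N w multiplies the
    determinant by the last entry of \<open>w\<close>, which is 1.\<close>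
  have "det N = det R"
    unfolding R_def using cramer_lemma_mat[OF N w, of m] by (simp add: w_def)
  also have "\<dots> = (\<Sum>i<Suc m. R $$ (i, m) * cofactor R i m)"
    using laplace_expansion_column[OF R, of m] by simp
  also have "\<dots> = g * cofactor R m m + (\<Sum>i<m. (- 1) ^ d * z d $ i * cofactor R i m)"
    using R_top R_bottom by (simp add: add.commute)
  finally have eq: "det N = g * cofactor R m m + (\<Sum>i<m. (- 1) ^ d * z d $ i * cofactor R i m)" .
  interpret cp: comm_ring_hom "const_part :: 'a mpoly \<Rightarrow> 'a"
    by (rule const_part_comm_ring_hom)
  have "const_part (N $$ (i, j)) = (if i = j then 1 else 0)" if "i < m" "j < m" for i j
  proof -
    have "const_part (Y $$ (i, j)) = 0"
      using homogeneous_poly_lookup[OF homY[OF that], of 0] by (simp add: const_part_def mon_degree_def)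
    then show ?thesis
      using that by (simp add: Y_def cp.hom_minus split: if_splits)
  qed
  \<comment> \<open>Deleting the last row and column removes the replaced column and leaves I + Y,
    whose constant part is the identity.\<close>
  then have "map_mat const_part (mat_delete R m m) = 1\<^sub>m m"
    using N by (intro eq_matI) (auto simp: R_def replace_col_def mat_delete_def)
  then have "const_part (det (mat_delete R m m)) = 1"
    by (metis cp.hom_det det_one)
  then have q: "const_part (cofactor R m m) = 1"
    by (simp add: cofactor_def)
  have r: "order_ge (Suc d) (\<Sum>i<m. (- 1) ^ d * z d $ i * cofactor R i m)"
  proof (intro order_ge_sum)
    fix i assume "i \<in> {..<m}"
    then have "order_ge (Suc d) ((- 1) ^ d * z d $ i)"
      by (intro order_ge_homogeneous homogeneous_poly_sign_mult homz) simp
    then show "order_ge (Suc d) ((- 1) ^ d * z d $ i * cofactor R i m)"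
      using order_ge_mult[of "Suc d" _ 0] by simp
  qed
  let ?h = "- ((- 1) ^ e * (u \<bullet> z e))"
  have h: "homogeneous_poly d ?h"
    using homogeneous_poly_sign_mult[OF homuz, of e e] by (simp add: d_def)
  have "det N = ?h"
  proof (rule poly_mapping_eqI)
    fix \<mu>
    show "Poly_Mapping.lookup (det N) \<mu> = Poly_Mapping.lookup ?h \<mu>"
    proof (cases "mon_degree \<mu> = d")
      case True
      \<comment> \<open>This is where degree at least 2 matters: the linear corner entry of
        \<open>N\<close> contributes nothing in degree \<open>d\<close>.\<close>
      have "d \<noteq> 1"
        by (simp add: d_def)
      \<comment> \<open>The j-th summand is homogeneous of degree j + 2, so only j = e reaches
        degree \<open>d\<close>.\<close>
      have "Poly_Mapping.lookup ((- 1) ^ j * (u \<bullet> z j)) \<mu> = 0" if "j \<noteq> e" for j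
        using that True homogeneous_poly_lookup[OF homogeneous_poly_sign_mult[OF homuz]] by (simp add: d_def)
      then have "(\<Sum>j<d. Poly_Mapping.lookup ((- 1) ^ j * (u \<bullet> z j)) \<mu>)
          = (\<Sum>j<d. if j = e then Poly_Mapping.lookup ((- 1) ^ j * (u \<bullet> z j)) \<mu> else 0)"
        by (intro sum.cong) auto
      also have "\<dots> = Poly_Mapping.lookup ((- 1) ^ e * (u \<bullet> z e)) \<mu>"
        by (simp add: d_def)
      finally have "Poly_Mapping.lookup g \<mu> = Poly_Mapping.lookup ?h \<mu>"
        using homogeneous_poly_lookup[of 1 "N $$ (m, m)" \<mu>] hom[of m m] True \<open>d \<noteq> 1\<close>
        by (simp add: g_def lookup_minus lookup_sum)
      then show ?thesis
        using lookup_quotient[OF _ r q eq True] f by (simp add: order_ge_homogeneous d_def)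
    next
      case False
      then show ?thesis
        using homogeneous_poly_lookup[OF h] homogeneous_poly_lookup[OF f] by (simp add: d_def)
    qed
  qed
  then show ?thesis
    by (simp add: z_def)
qed

section \<open>From determinantal representations to ABPs\<close>

text \<open>Connects the entries allowed in homogeneous ABPs with the grading used for
  determinants.\<close>

lemma hom_linear_fn_iff:
  "hom_linear_fn n p \<longleftrightarrow> p \<in> polys_in n \<and> homogeneous_poly 1 (p :: 'a::field mpoly)"
proof -
  have const: "const_part p = 0 \<longleftrightarrow> (\<forall>m\<in>Poly_Mapping.keys p. mon_degree m \<noteq> 0)"
    unfolding const_part_def mon_degree_0_iff by (metis in_keys_iff)
  have deg: "mon_degree m = 1 \<longleftrightarrow> mon_degree m \<le> 1 \<and> mon_degree m \<noteq> 0" for m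
    by linarith
  show ?thesis
    unfolding hom_linear_fn_def linear_fn_def homogeneous_poly_def const deg by blast
qed

section \<open>Linear functions under multiplication by constant matrices\<close>

lemma linear_fn_add:
  "linear_fn n p \<Longrightarrow> linear_fn n q \<Longrightarrow> linear_fn n (p + q)"
  unfolding linear_fn_def polys_in_def using Poly_Mapping.keys_add[of p q] by blast

lemma linear_fn_sum:
  "(\<And>i. i \<in> I \<Longrightarrow> linear_fn n (p i)) \<Longrightarrow> linear_fn n (sum p I)"
proof (induction I rule: infinite_finite_induct)
  case (insert x F)
  then show ?case by (simp add: linear_fn_add)
qed (simp_all add: linear_fn_def polys_in_def)

lemma linear_fn_single_mult:
  "linear_fn n p \<Longrightarrow> linear_fn n (Poly_Mapping.single 0 c * p :: 'a::field mpoly)"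
  unfolding linear_fn_def polys_in_def
  using keys_mult[of "Poly_Mapping.single 0 c" p] by (fastforce split: if_splits)

lemma linear_fn_mult_mat_left:
  assumes P: "P \<in> carrier_mat s s" and M: "M \<in> carrier_mat s s"
    and "\<And>i j. i < s \<Longrightarrow> j < s \<Longrightarrow> linear_fn n (M $$ (i, j))" "i < s" "j < s"
  shows "linear_fn n ((map_mat (Poly_Mapping.single 0) P * M) $$ (i, j) :: 'a::field mpoly)"
  using assms by (auto simp: scalar_prod_def intro!: linear_fn_sum linear_fn_single_mult)

lemma linear_fn_mult_mat_right:
  assumes Q: "Q \<in> carrier_mat s s" and M: "M \<in> carrier_mat s s"
    and "\<And>i j. i < s \<Longrightarrow> j < s \<Longrightarrow> linear_fn n (M $$ (i, j))" "i < s" "j < s"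
  shows "linear_fn n ((M * map_mat (Poly_Mapping.single 0) Q) $$ (i, j) :: 'a::field mpoly)"
  using assms
  by (auto simp: scalar_prod_def mult.commute[of _ "Poly_Mapping.single 0 _"]
      intro!: linear_fn_sum linear_fn_single_mult)

lemma hom_linear_fn_minus_const:
  fixes p :: "'a::field mpoly"
  assumes "linear_fn n p" "const_part p = c"
  shows "hom_linear_fn n (p - Poly_Mapping.single 0 c)"
proof -
  have "linear_fn n (Poly_Mapping.single 0 c)"
    by (simp add: linear_fn_def polys_in_def mon_degree_def)
  then have "linear_fn n (p - Poly_Mapping.single 0 c)"
    using assms(1) Poly_Mapping.keys_diff[of p "Poly_Mapping.single 0 c"]
    unfolding linear_fn_def polys_in_def by blast
  then show ?thesis
    using assms(2) by (simp add: hom_linear_fn_def const_part_def lookup_minus)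
qed

lemma hom_linear_fn_single_mult:
  "hom_linear_fn n p \<Longrightarrow> hom_linear_fn n (Poly_Mapping.single 0 c * p :: 'a::field mpoly)"
  by (auto simp: hom_linear_fn_def const_part_mult intro: linear_fn_single_mult)

text \<open>The matrices \<open>P\<close> and \<open>Q\<close> that normalise M(0) are constant, so
  multiplying \<open>M\<close> by them keeps the entries linear, turns the constant part into the
  normal form, and scales the determinant by the nonzero constant det P det Q.\<close>

lemma regular_det_rep_normal_form:
  fixes f :: "'a::field mpoly"
  assumes "regular_det_rep n (Suc m) M f"
  obtains N c where "c \<noteq> 0" "N \<in> carrier_mat (Suc m) (Suc m)"
    "det N = Poly_Mapping.single 0 c * f"
    "\<And>i j. i < Suc m \<Longrightarrow> j < Suc m \<Longrightarrow>
      hom_linear_fn n (N $$ (i, j) - (if i = j \<and> i < m then 1 else 0))"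
proof -
  let ?s = "Suc m" and ?C = "map_mat (Poly_Mapping.single 0) :: 'a mat \<Rightarrow> 'a mpoly mat"
  interpret cp: comm_ring_hom "const_part :: 'a mpoly \<Rightarrow> 'a"
    by (rule const_part_comm_ring_hom)
  interpret sg: comm_ring_hom "Poly_Mapping.single 0 :: 'a \<Rightarrow> 'a mpoly"
    by (rule single_0_comm_ring_hom)
  have M: "M \<in> carrier_mat ?s ?s" and detM: "det M = f"
    and lin: "\<And>i j. i < ?s \<Longrightarrow> j < ?s \<Longrightarrow> linear_fn n (M $$ (i, j))"
    and rank: "vec_space.rank ?s (map_mat const_part M) = m"
    using assms by (auto simp: regular_det_rep_def det_rep_def)
  obtain P Q where P: "P \<in> carrier_mat ?s ?s" and Q: "Q \<in> carrier_mat ?s ?s"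
    and det0: "det P \<noteq> 0" "det Q \<noteq> 0"
    and PQ: "P * map_mat const_part M * Q = corank_one_mat m"
    using corank_one_normal_form[of "map_mat const_part M" m] M rank by auto
  define N where "N = ?C P * M * ?C Q"
  have PM: "?C P * M \<in> carrier_mat ?s ?s"
    using P M by simp
  have N: "N \<in> carrier_mat ?s ?s"
    using P M Q by (simp add: N_def)
  have const_C: "map_mat const_part (?C X) = X" for X
    by (intro eq_matI) (auto simp: const_part_def)
  have linN: "linear_fn n (N $$ (i, j))" if "i < ?s" "j < ?s" for i j
    unfolding N_def using that
    by (intro linear_fn_mult_mat_right[OF Q PM] linear_fn_mult_mat_left[OF P M] lin)
  have corank: "map_mat const_part N = corank_one_mat m"
    unfolding N_def using P M Q PQ
    by (simp add: cp.mat_hom_mult[of _ ?s ?s _ ?s] const_C)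
  have constN: "const_part (N $$ (i, j)) = (if i = j \<and> i < m then 1 else 0)"
    if "i < ?s" "j < ?s" for i j
    using that N arg_cong[OF corank, of "\<lambda>X. X $$ (i, j)"]
    by (simp add: corank_one_mat_def)
  have homN: "hom_linear_fn n (N $$ (i, j) - (if i = j \<and> i < m then 1 else 0))"
    if "i < ?s" "j < ?s" for i j
    using hom_linear_fn_minus_const[OF linN[OF that] constN[OF that]]
    by (cases "i = j \<and> i < m") auto
  have "det N = det (?C P) * det M * det (?C Q)"
    unfolding N_def using P M Q by (simp add: det_mult[of _ ?s])
  then have "det N = Poly_Mapping.single 0 (det P * det Q) * f"
    by (simp add: sg.hom_mult detM ac_simps)
  with det0 N homN that show thesis
    by (metis no_zero_divisors)
qed

lemma foldr_const_fun: "foldr (\<lambda>_. g) xs c = (g ^^ length xs) c"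
  by (induction xs) auto

text \<open>The ABP has \<open>e\<close> equal matrices \<open>Y\<close> and hence
  \<open>Suc e\<close> layers of dimension \<open>m\<close>. For e = 0 it is a plain scalar
  product.\<close>

lemma regular_det_rep_has_abp:
  fixes f :: "'a::field mpoly"
  assumes rep: "regular_det_rep n (Suc m) M f" and f: "homogeneous_poly (e + 2) f"
  shows "has_abp (hom_linear_fn n) m (Suc e * m) f"
proof -
  obtain N c where c: "c \<noteq> 0" and N: "N \<in> carrier_mat (Suc m) (Suc m)"
    and detN: "det N = Poly_Mapping.single 0 c * f"
    and hom: "\<And>i j. i < Suc m \<Longrightarrow> j < Suc m \<Longrightarrow>
      hom_linear_fn n (N $$ (i, j) - (if i = j \<and> i < m then 1 else 0))"
    using regular_det_rep_normal_form[OF rep] by metis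
  define Y where "Y = mat m m (\<lambda>(i, j). N $$ (i, j) - (if i = j then 1 else 0))"
  define u where "u = vec m (\<lambda>j. N $$ (m, j))"
  define v where "v = vec m (\<lambda>i. N $$ (i, m))"
  \<comment> \<open>The sign and the factor \<open>c\<close> introduced by the normal form are
    absorbed into the first vector, which stays homogeneous linear.\<close>
  define b where "b = Poly_Mapping.single 0 (- (inverse c * (- 1) ^ e)) \<cdot>\<^sub>v u"
  have "homogeneous_poly (0 + (e + 2)) (det N)"
    unfolding detN by (intro homogeneous_poly_mult f) (simp add: homogeneous_poly_def)
  then have det_eq: "det N = - ((- 1) ^ e * (u \<bullet> ((*\<^sub>v) Y ^^ e) v))"
    unfolding Y_def u_def v_def using hom
    by (intro homogeneous_det_corank_one[OF N]) (auto simp: hom_linear_fn_iff)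
  have Y: "Y \<in> carrier_mat m m" and u: "u \<in> carrier_vec m" and v: "v \<in> carrier_vec m"
    by (auto simp: Y_def u_def v_def)
  interpret sg: comm_ring_hom "Poly_Mapping.single 0 :: 'a \<Rightarrow> 'a mpoly"
    by (rule single_0_comm_ring_hom)
  have "f = Poly_Mapping.single 0 (inverse c) * det N"
    using c by (simp add: detN mult.assoc[symmetric] mult_single)
  also have "\<dots> = b \<bullet> ((*\<^sub>v) Y ^^ e) v"
    using Y u v by (simp add: det_eq b_def sg.hom_mult sg.hom_uminus sg.hom_power)
  finally have f_eq: "f = b \<bullet> foldr (\<lambda>i w. Y *\<^sub>v w) [1..<Suc e] v"
    by (simp add: foldr_const_fun del: upt_Suc)
  have hom_u: "hom_linear_fn n (u $ i)" and hom_v: "hom_linear_fn n (v $ i)" if "i < m" for i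
    using that hom[of m i] hom[of i m] by (auto simp: u_def v_def)
  have hom_Y: "hom_linear_fn n (Y $$ (i, j))" if "i < m" "j < m" for i j
    using that hom[of i j] by (auto simp: Y_def)
  have "abp_of (hom_linear_fn n) e (\<lambda>_. m) b (\<lambda>_. Y) v f"
    unfolding abp_of_def using Y u v f_eq hom_u hom_v hom_Y
    by (auto simp: b_def vec_set_def dest!: elements_matD intro: hom_linear_fn_single_mult)
  then show ?thesis
    unfolding has_abp_def by (intro exI conjI) auto
qed

text \<open>Serves twice: to relax the size bound, and to regard a homogeneous ABP as an
  ABP.\<close>

lemma has_abp_mono:
  assumes "has_abp L width s f" "\<And>p. L p \<Longrightarrow> L' p" "s \<le> s'"
  shows "has_abp L' width s' f"
proof -
  obtain k w b M c where "abp_of L k w b M c f" "\<forall>i\<le>k. w i \<le> width" "(\<Sum>i=0..k. w i) \<le> s"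
    using assms(1) by (auto simp: has_abp_def)
  moreover from this have "abp_of L' k w b M c f"
    using assms(2) by (auto simp: abp_of_def)
  ultimately show ?thesis
    unfolding has_abp_def using assms(3)
    by (intro exI[of _ k] exI[of _ w] exI[of _ b] exI[of _ M] exI[of _ c]) simp
qed

theorem theorem3p1:
  fixes f :: "'a::field mpoly" and n d s :: nat
  assumes "f \<in> polys_in n"
    and "homogeneous_poly d f"
    and "d \<ge> 2"
    and "rdc n f = enat s"
  shows "habpw n f \<le> enat (s - 1) \<and> abp n f \<le> habp n f \<and> habp n f \<le> enat (d * s)"
proof -
  let ?R = "{enat s | s. \<exists>M. regular_det_rep n s M f}"
  have "?R \<noteq> {}"
  proof
    assume "?R = {}"
    then show False
      using assms(4) unfolding rdc_def by (simp only: Inf_enat_def) simp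
  qed
  \<comment> \<open>A nonempty set of extended naturals attains its infimum, so a regular
    representation of size exactly \<open>s\<close> exists.\<close>
  then have "Inf ?R \<in> ?R"
    using LeastI[of "\<lambda>x. x \<in> ?R"] unfolding Inf_enat_def by auto
  then obtain M where M: "regular_det_rep n s M f"
    using assms(4) by (auto simp: rdc_def)
  \<comment> \<open>The additive rank condition excludes s = 0.\<close>
  then obtain m where m: "s = Suc m"
    unfolding regular_det_rep_def by (metis Suc_eq_plus1)
  obtain e where e: "d = e + 2"
    using assms(3) by (metis add.commute le_Suc_ex)
  have "has_abp (hom_linear_fn n) m (Suc e * m) f"
    using regular_det_rep_has_abp M assms(2) by (simp add: m e)
  \<comment> \<open>The construction has size (d - 1) (s - 1), so O(ds) holds with constant
    1.\<close>
  then have *: "has_abp (hom_linear_fn n) m (d * s) f"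
    by (rule has_abp_mono) (auto simp: m e)
  have "habpw n f \<le> enat (s - 1)"
    unfolding habpw_def using * by (intro Inf_lower) (auto simp: m)
  moreover have "habp n f \<le> enat (d * s)"
    unfolding habp_def using * by (intro Inf_lower) auto
  moreover have "abp n f \<le> habp n f"
  proof -
    have "has_abp (linear_fn n) width t f" if "has_abp (hom_linear_fn n) width t f" for width t
      using has_abp_mono[OF that, of "linear_fn n" t] by (simp add: hom_linear_fn_def)
    then show ?thesis
      unfolding abp_def habp_def by (intro Inf_superset_mono) blast
  qed
  ultimately show ?thesis by blast
qed

end
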